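(* There exist a prime $p$, a Cohen-Macaulay local ring $(R,\mathfrak m)$ of characteristic $p$ with $d=\dim R\ge 1$, and an ideal $J$ of $R$ generated by a full system of parameters such that, with $a:=\max\{n:\mathfrak m^n\nsubseteq J\}$, the following statement fails: for every positive integer $s$, $\mathfrak m^s\subseteq\overline J$ if and only if $s\ge\frac{a}{d}+1$.
   Context: $\overline J$ denotes the integral closure of the ideal $J$: the set of $r\in R$ satisfying an equation $r^n+a_1r^{n-1}+\cdots+a_n=0$ with $a_i\in J^i$. (For regular local rings of characteristic $p>0$ the displayed equivalence is known to hold; the question was whether "regular" can be replaced by "Cohen-Macaulay".) *)

theory Defs
  imports Complex_Main "HOL-Library.Extended_Nat" "HOL-Computational_Algebra.Primes"
    "HOL-Algebra.Algebra"
begin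

text \<open>
  Powers of ideals are the library powers in the monoid of ideals: \<open>I [^]\<^bsub>ideals_set R\<^esub> n\<close>
  is the \<open>n\<close>-fold ideal product of \<open>I\<close>, and the whole ring for \<open>n = 0\<close>.
\<close>

abbreviation ideal_power :: "('a, 'b) ring_scheme \<Rightarrow> 'a set \<Rightarrow> nat \<Rightarrow> 'a set" where
  "ideal_power R I n \<equiv> I [^]\<^bsub>ideals_set R\<^esub> n"

text \<open>Local rings are commutative and Noetherian by convention.\<close>

locale local_ring = cring R + noetherian_ring R for R (structure) +
  fixes \<mm>
  assumes maximal: "maximalideal \<mm> R"
    and unique: "maximalideal I R \<Longrightarrow> I = \<mm>"

text \<open>The kernel of the canonical map from the integers to \<open>R\<close> is generated by \<open>p\<close>.\<close>

definition has_characteristic :: "('a, 'b) ring_scheme \<Rightarrow> nat \<Rightarrow> bool" where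
  "has_characteristic R p \<longleftrightarrow> (\<forall>k::nat. add_pow R k \<one>\<^bsub>R\<^esub> = \<zero>\<^bsub>R\<^esub> \<longleftrightarrow> p dvd k)"

definition krull_dim :: "('a, 'b) ring_scheme \<Rightarrow> enat" where
  "krull_dim R = Sup {enat n | n. \<exists>P :: nat \<Rightarrow> 'a set.
     (\<forall>i\<le>n. primeideal (P i) R) \<and> (\<forall>i<n. P i \<subset> P (Suc i))}"

definition regular_sequence :: "('a, 'b) ring_scheme \<Rightarrow> 'a list \<Rightarrow> bool" where
  "regular_sequence R xs \<longleftrightarrow> set xs \<subseteq> carrier R \<and> Idl\<^bsub>R\<^esub> (set xs) \<noteq> carrier R \<and>
     (\<forall>i<length xs. \<forall>r\<in>carrier R.
        (xs ! i) \<otimes>\<^bsub>R\<^esub> r \<in> Idl\<^bsub>R\<^esub> (set (take i xs)) \<longrightarrow> r \<in> Idl\<^bsub>R\<^esub> (set (take i xs)))"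

definition depth :: "('a, 'b) ring_scheme \<Rightarrow> 'a set \<Rightarrow> enat" where
  "depth R \<mm> = Sup {enat (length xs) | xs. set xs \<subseteq> \<mm> \<and> regular_sequence R xs}"

locale cohen_macaulay_local_ring = local_ring +
  assumes depth_eq_dim: "depth R \<mm> = krull_dim R"

definition ideal_radical :: "('a, 'b) ring_scheme \<Rightarrow> 'a set \<Rightarrow> 'a set" where
  "ideal_radical R I = {r \<in> carrier R. \<exists>n::nat. r [^]\<^bsub>R\<^esub> n \<in> I}"

definition system_of_parameters :: "('a, 'b) ring_scheme \<Rightarrow> 'a set \<Rightarrow> 'a list \<Rightarrow> bool" where
  "system_of_parameters R \<mm> xs \<longleftrightarrow> set xs \<subseteq> \<mm> \<and> enat (length xs) = krull_dim R \<and>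
     ideal_radical R (Idl\<^bsub>R\<^esub> (set xs)) = \<mm>"

definition ideal_integral_closure :: "('a, 'b) ring_scheme \<Rightarrow> 'a set \<Rightarrow> 'a set" where
  "ideal_integral_closure R J = {r \<in> carrier R. \<exists>n a. n \<ge> 1 \<and>
     (\<forall>i\<in>{1..n}. a i \<in> ideal_power R J i) \<and>
     r [^]\<^bsub>R\<^esub> n \<oplus>\<^bsub>R\<^esub> (\<Oplus>\<^bsub>R\<^esub>i\<in>{1..n}. a i \<otimes>\<^bsub>R\<^esub> r [^]\<^bsub>R\<^esub> (n - i)) = \<zero>\<^bsub>R\<^esub>}"

text \<open>
  HOL cannot quantify existentially over types, so a ring whose existence is asserted needs a
  fixed carrier type. The type \<open>nat set\<close> serves as a universe: a ring with at most continuum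
  many elements has an isomorphic copy whose carrier is a subset of it.
\<close>

type_synonym universe = "nat set"

end

theory Submission
  imports Defs "HOL-Computational_Algebra.Formal_Power_Series" "HOL-Library.Z2"
begin

text \<open>
  Take the cuspidal cubic \<open>R = k[[t\<^sup>2, t\<^sup>3]]\<close>, a one-dimensional Cohen-Macaulay domain that is not
  regular, and \<open>J = (t\<^sup>2)\<close>. Then \<open>J\<close> is a reduction of \<open>\<mm> = (t\<^sup>2, t\<^sup>3)\<close>, so \<open>\<mm>\<close> lies in the
  integral closure of \<open>J\<close>, although \<open>\<mm>\<close> is not contained in \<open>J\<close> while \<open>\<mm>\<^sup>2\<close> is. Hence
  \<open>a = d = 1\<close>, and the equivalence fails at \<open>s = 1 < a/d + 1\<close>.

  The ideal theory of \<open>R\<close> is governed by the \<open>t\<close>-adic valuation: every ideal containing an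
  element of order \<open>n\<close> contains all elements of order at least \<open>n + 2\<close>. For the field \<open>k\<close> with two
  elements, a power series is coded by its support, a set of natural numbers.
\<close>

lemma enat_one_le_iff: "1 \<le> n \<longleftrightarrow> n \<noteq> 0" for n :: enat
  by (cases n) (auto simp: one_enat_def zero_enat_def)

lemma (in cring) genideal_empty: "Idl {} = {\<zero>}"
  using genideal_minimal[OF zeroideal, of "{}"] genideal_ideal[of "{}"]
    additive_subgroup.zero_closed[OF ideal.axioms(1)] by blast

lemma (in ring) has_characteristic_two:
  assumes "\<one> \<oplus> \<one> = \<zero>" "\<one> \<noteq> \<zero>"
  shows "has_characteristic R 2"
proof -
  have "add_pow R k \<one> = (if even k then \<zero> else \<one>)" for k :: nat
    by (induction k) (use assms in auto)
  then show ?thesis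
    using assms(2) by (simp add: has_characteristic_def)
qed

text \<open>The abstract features of \<open>k[[t\<^sup>2, t\<^sup>3]]\<close> and its \<open>t\<close>-adic valuation.\<close>

locale cusp_domain = domain R for R (structure) +
  fixes v :: "'a \<Rightarrow> enat"
  assumes v_eq_infinity_iff: "x \<in> carrier R \<Longrightarrow> v x = \<infinity> \<longleftrightarrow> x = \<zero>"
    and v_mult: "\<lbrakk>x \<in> carrier R; y \<in> carrier R\<rbrakk> \<Longrightarrow> v (x \<otimes> y) = v x + v y"
    and v_add: "\<lbrakk>x \<in> carrier R; y \<in> carrier R\<rbrakk> \<Longrightarrow> min (v x) (v y) \<le> v (x \<oplus> y)"
    and v_neq_one: "x \<in> carrier R \<Longrightarrow> v x \<noteq> 1"
    and two_in_range: "\<exists>x\<in>carrier R. v x = 2"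
    and three_in_range: "\<exists>x\<in>carrier R. v x = 3"
    and conductor: "\<lbrakk>x \<in> carrier R; y \<in> carrier R; v x + 2 \<le> v y\<rbrakk>
      \<Longrightarrow> \<exists>z\<in>carrier R. y = z \<otimes> x"
    and leading_term: "\<lbrakk>x \<in> carrier R; y \<in> carrier R; x \<noteq> \<zero>; v x = v y\<rbrakk>
      \<Longrightarrow> \<exists>c\<in>carrier R. \<exists>z\<in>carrier R. y = c \<otimes> x \<oplus> z \<and> v x < v z"
begin

section \<open>Arithmetic of the valuation and the ideals it cuts out\<close>

lemma v_one: "v \<one> = 0"
proof -
  have "v \<one> = v \<one> + v \<one>" using v_mult[of \<one> \<one>] by simp
  moreover have "v \<one> \<noteq> \<infinity>" by (simp add: v_eq_infinity_iff)
  ultimately show ?thesis by (cases "v \<one>") (auto simp: zero_enat_def)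
qed

lemma v_zero: "v \<zero> = \<infinity>"
  by (simp add: v_eq_infinity_iff)

lemma v_pow: "x \<in> carrier R \<Longrightarrow> v (x [^] n) = of_nat n * v x" for n :: nat
  by (induction n) (simp_all add: v_one v_mult algebra_simps)

lemma two_le_v: "x \<in> carrier R \<Longrightarrow> 1 \<le> v x \<Longrightarrow> 2 \<le> v x"
  using v_neq_one[of x] by (cases "v x") (auto simp: one_enat_def numeral_eq_enat)

lemma v_ideal: "ideal {x \<in> carrier R. n \<le> v x} R"
proof (rule idealI[OF ring_axioms])
  show "subgroup {x \<in> carrier R. n \<le> v x} (add_monoid R)"
  proof (rule add.subgroupI)
    fix x assume x: "x \<in> {x \<in> carrier R. n \<le> v x}"
    \<comment> \<open>Multiplying by a ring element never lowers the order, so closure under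
      negation needs no value for the order of minus one.\<close>
    have "\<ominus> x = \<ominus> \<one> \<otimes> x" using x by (simp add: l_minus)
    then have "v (\<ominus> x) = v (\<ominus> \<one>) + v x" using x v_mult[of "\<ominus> \<one>" x] by simp
    then show "\<ominus> x \<in> {x \<in> carrier R. n \<le> v x}"
      using x by (simp add: add_increasing)
  next
    fix x y
    assume "x \<in> {x \<in> carrier R. n \<le> v x}" "y \<in> {x \<in> carrier R. n \<le> v x}"
    then have "x \<in> carrier R" "y \<in> carrier R" "n \<le> min (v x) (v y)" by simp_all
    then show "x \<oplus> y \<in> {x \<in> carrier R. n \<le> v x}"
      using order_trans[OF _ v_add] by simp
  next
    have "\<zero> \<in> {x \<in> carrier R. n \<le> v x}" by (simp add: v_zero)
    then show "{x \<in> carrier R. n \<le> v x} \<noteq> {}" by blast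
  qed simp
qed (auto simp: v_mult add_increasing add_increasing2)

definition \<mm> :: "'a set" where "\<mm> = {x \<in> carrier R. 1 \<le> v x}"

lemma ideal_\<mm>: "ideal \<mm> R"
  unfolding \<mm>_def by (rule v_ideal)

text \<open>The main tool for ideal membership: a quotient of order at least 2 lies in the ring, so
  only orders below \<open>v x + 2\<close> ever need attention.\<close>

lemma ideal_above_conductor:
  assumes "ideal I R" "x \<in> I" "y \<in> carrier R" "v x + 2 \<le> v y"
  shows "y \<in> I"
  using conductor[of x y] assms ideal.I_l_closed ideal.Icarr by metis

text \<open>Cancelling the leading term of the unit element against \<open>x\<close> leaves a
  remainder of positive order. Since order 1 does not occur, its order is at least 2 and the
  conductor absorbs it into \<open>I\<close>.\<close>

lemma one_in_ideal:
  assumes I: "ideal I R" and x: "x \<in> I" "v x = 0"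
  shows "I = carrier R"
proof -
  have xc: "x \<in> carrier R" using I x(1) by (rule ideal.Icarr)
  then have "x \<noteq> \<zero>" using x(2) v_zero by auto
  then obtain c z where cz: "c \<in> carrier R" "z \<in> carrier R" "\<one> = c \<otimes> x \<oplus> z" "v x < v z"
    using leading_term[of x \<one>] xc x(2) v_one by auto
  have "2 \<le> v z" using cz(2,4) x(2) two_le_v[of z] by (simp add: enat_one_le_iff)
  then have "z \<in> I" using ideal_above_conductor[OF I x(1) cz(2)] x(2) by simp
  then have "\<one> \<in> I" 
    using cz(1,3) x(1) I by (simp add: ideal.I_l_closed additive_subgroup.a_closed ideal.axioms(1))
  then show ?thesis using I by (simp add: ideal.one_imp_carrier)
qed

lemma one_notin_\<mm>: "\<one> \<notin> \<mm>"
  by (simp add: \<mm>_def v_one)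

lemma proper_ideal_subset: 
  assumes "ideal I R" "I \<noteq> carrier R"
  shows "I \<subseteq> \<mm>"
proof
  fix x assume "x \<in> I"
  then show "x \<in> \<mm>"
    using one_in_ideal[OF assms(1)] assms(2) ideal.Icarr[OF assms(1)]
    by (auto simp: \<mm>_def enat_one_le_iff)
qed

lemma maximalideal_\<mm>: "maximalideal \<mm> R"
proof (rule maximalidealI[OF ideal_\<mm>])
  show "carrier R \<noteq> \<mm>" using one_notin_\<mm> by auto
qed (use proper_ideal_subset in blast)

lemma maximalideal_unique:
  assumes "maximalideal I R"
  shows "I = \<mm>"
proof -
  interpret maximalideal I R by fact
  show ?thesis
    using I_maximal[OF ideal_\<mm>] proper_ideal_subset[OF is_ideal] I_notcarr one_notin_\<mm>
      \<mm>_def by auto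
qed

section \<open>Prime ideals and Krull dimension\<close>

text \<open>Orders of powers of \<open>y\<close> grow without bound, so they pass the conductor
  bound of \<open>x\<close>, which is finite because \<open>x\<close> is nonzero. This serves the
  prime ideals, the depth bound and the radical alike.\<close>

lemma exists_pow_in_ideal:
  assumes "ideal I R" "x \<in> I" "x \<noteq> \<zero>" "y \<in> \<mm>"
  shows "\<exists>n::nat. y [^] n \<in> I"
proof -
  have xc: "x \<in> carrier R" using assms(1,2) by (rule ideal.Icarr)
  then obtain k where k: "v x = enat k" using v_eq_infinity_iff assms(3) by auto
  have y: "y \<in> carrier R" "1 \<le> v y" using assms(4) by (auto simp: \<mm>_def)
  have "v x + 2 = of_nat (k + 2) * 1" 
    by (simp add: k of_nat_eq_enat numeral_eq_enat)
  also have "\<dots> \<le> v (y [^] (k + 2))" unfolding v_pow[OF y(1)] using y(2) by (rule mult_left_mono) simp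
  finally show ?thesis using ideal_above_conductor[OF assms(1,2)] y(1) by blast
qed

text \<open>A nonzero prime contains a power of every element of \<open>\<mm>\<close>, hence the
  element itself.\<close>

lemma primeideal_cases:
  assumes "primeideal P R"
  shows "P = {\<zero>} \<or> P = \<mm>"
proof -
  interpret P: primeideal P R by fact
  have "P = \<mm>" if x: "x \<in> P" "x \<noteq> \<zero>" for x
  proof
    show "P \<subseteq> \<mm>" using proper_ideal_subset[OF P.is_ideal] P.I_notcarr by auto
    show "\<mm> \<subseteq> P"
    proof
      fix y assume y: "y \<in> \<mm>"
      then have yc: "y \<in> carrier R" by (simp add: \<mm>_def)
      obtain n :: nat where "y [^] n \<in> P"
        using exists_pow_in_ideal[OF P.is_ideal x y] by auto
      then show "y \<in> P"
      proof (induction n)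
        case 0
        then show ?case using P.one_imp_carrier P.I_notcarr by auto
      next
        case (Suc n)
        then show ?case using P.I_prime[of "y [^] n" y] yc by auto
      qed
    qed
  qed
  then show ?thesis using P.zero_closed by blast
qed

lemma krull_dim_eq_one: "krull_dim R = 1"
  unfolding krull_dim_def
proof (rule antisym[OF Sup_least Sup_upper])
  fix e
  assume "e \<in> {enat n | n. \<exists>P :: nat \<Rightarrow> 'a set.
     (\<forall>i\<le>n. primeideal (P i) R) \<and> (\<forall>i<n. P i \<subset> P (Suc i))}"
  then obtain n and P :: "nat \<Rightarrow> 'a set" where e: "e = enat n"
    and P: "\<forall>i\<le>n. primeideal (P i) R" "\<forall>i<n. P i \<subset> P (Suc i)" by blast
  have "n \<le> 1"
  proof (rule ccontr)
    assume "\<not> n \<le> 1"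
    then have chain: "P 0 \<subset> P 1" "P 1 \<subset> P 2"
      using P(2)[rule_format, of 0] P(2)[rule_format, of 1] by (simp_all add: numeral_2_eq_2)
    have "P i = {\<zero>} \<or> P i = \<mm>" if "i \<le> 2" for i
      using primeideal_cases P(1) that \<open>\<not> n \<le> 1\<close> by auto
    from this[of 0] this[of 1] this[of 2] chain show False
      using ideal_\<mm> additive_subgroup.zero_closed[OF ideal.axioms(1)] by auto
  qed
  then show "e \<le> 1" by (simp add: e one_enat_def)
next
  obtain b where b: "b \<in> carrier R" "v b = 2" using two_in_range by auto
  define P where "P i = (if i = 0 then {\<zero>} else \<mm>)" for i :: nat
  have "b \<in> \<mm>" "b \<noteq> \<zero>" using b v_zero by (auto simp: \<mm>_def)
  moreover have "\<zero> \<in> \<mm>" by (simp add: \<mm>_def v_zero)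
  ultimately have "P 0 \<subset> P 1" by (auto simp: P_def)
  moreover have "primeideal (P i) R" for i
    using zeroprimeideal maximalideal_prime[OF maximalideal_\<mm>] by (simp add: P_def)
  ultimately show "1 \<in> {enat n | n. \<exists>P :: nat \<Rightarrow> 'a set.
     (\<forall>i\<le>n. primeideal (P i) R) \<and> (\<forall>i<n. P i \<subset> P (Suc i))}"
    by (auto simp: one_enat_def intro!: exI[of _ 1] exI[of _ P])
qed

section \<open>Noetherianity and depth\<close>

text \<open>Two generators suffice: \<open>f\<close> of least order in \<open>I\<close>, and
  \<open>g\<close> of least order among the elements of order above \<open>v f\<close>. Orders from
  \<open>v f + 2\<close> on are covered by \<open>f\<close> alone; at \<open>v f\<close> and
  \<open>v f + 1\<close> one leading term is cancelled, using \<open>f\<close> and \<open>g\<close>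
  respectively.\<close>

lemma noetherian: "noetherian_ring R"
proof (rule noetherian_ringI)
  fix I assume I: "ideal I R"
  interpret I: ideal I R by fact
  have ex_min: "\<exists>f\<in>S. \<forall>h\<in>S. v f \<le> v h" if "S \<noteq> {}" for S
    using that LeastI_ex[of "\<lambda>n. n \<in> v ` S"] Least_le[of "\<lambda>n. n \<in> v ` S"] by fastforce
  obtain f where f: "f \<in> I" "\<And>h. h \<in> I \<Longrightarrow> v f \<le> v h"
    using ex_min[of I] I.zero_closed by blast
  show "\<exists>A\<subseteq>carrier R. finite A \<and> I = Idl A"
  proof (cases "f = \<zero>")
    case True
    have "h = \<zero>" if "h \<in> I" for h
      using f(2)[OF that] v_eq_infinity_iff[OF I.Icarr[OF that]] by (simp add: True v_zero)
    then have "I = Idl {}" using I.zero_closed by (auto simp: genideal_empty)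
    then show ?thesis by blast
  next
    case False
    then have "v f < v \<zero>" using f(1) v_eq_infinity_iff[OF I.Icarr] by (auto simp: v_zero)
    \<comment> \<open>The minimum is taken over a nonempty set, because zero has infinite
      order.\<close>
    then obtain g where g: "g \<in> I" "v f < v g" "\<And>h. h \<in> I \<Longrightarrow> v f < v h \<Longrightarrow> v g \<le> v h"
      using ex_min[of "{h \<in> I. v f < v h}"] I.zero_closed by blast
    have fg: "f \<in> carrier R" "g \<in> carrier R" using f g by simp_all
    interpret J: ideal "Idl {f, g}" R using fg by (simp add: genideal_ideal)
    have gens: "f \<in> Idl {f, g}" "g \<in> Idl {f, g}" using genideal_self[of "{f, g}"] fg by auto
    have high: "h \<in> Idl {f, g}" if h: "h \<in> I" "v f < v h" for h
    proof -
      have hc: "h \<in> carrier R" using h by simp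
      consider "v f + 2 \<le> v h" | "v h = v f + 1"
        using h(2) by (cases "v f"; cases "v h") (force simp: numeral_eq_enat one_enat_def)+
      then show ?thesis
      proof cases
        case 1
        then show ?thesis using ideal_above_conductor[OF J.is_ideal gens(1) hc] by simp
      next
        case 2
        then have "v g = v h"
          using g(2) g(3)[OF h] by (cases "v f"; cases "v h"; cases "v g") (auto simp: one_enat_def)
        moreover have "g \<noteq> \<zero>" using 2 \<open>v g = v h\<close> \<open>v f < v \<zero>\<close> v_zero
          by (cases "v f") (auto simp: one_enat_def)
        ultimately obtain c z where cz: "c \<in> carrier R" "z \<in> carrier R"
          "h = c \<otimes> g \<oplus> z" "v g < v z"
          using leading_term[of g h] fg hc by auto
        have "v f + 2 \<le> v z" using 2 cz(4) \<open>v g = v h\<close>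
          by (cases "v f"; cases "v z") (auto simp: one_enat_def numeral_eq_enat)
        then have "z \<in> Idl {f, g}" using ideal_above_conductor[OF J.is_ideal gens(1) cz(2)] by simp
        then show ?thesis using cz gens(2) by (simp add: J.I_l_closed)
      qed
    qed
    have "I \<subseteq> Idl {f, g}"
    proof
      fix h assume h: "h \<in> I"
      then have hc: "h \<in> carrier R" by simp
      show "h \<in> Idl {f, g}"
      proof (cases "v f < v h")
        case True
        then show ?thesis using high h by simp
      next
        case low: False
        then have "v f = v h" using f(2)[OF h] by simp
        then obtain c z where cz: "c \<in> carrier R" "z \<in> carrier R" "h = c \<otimes> f \<oplus> z" "v f < v z"
          using leading_term[of f h] fg hc False by auto
        \<comment> \<open>The remainder is rewritten as a difference to see that it stays in
          \<open>I\<close>, as \<open>high\<close> requires.\<close>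
        have "z = h \<ominus> c \<otimes> f" using cz fg by (simp add: minus_eq a_ac r_neg r_neg2)
        then have "z \<in> I" using h cz(1) f(1) I.a_inv_closed I.I_l_closed by (simp add: minus_eq)
        then have "z \<in> Idl {f, g}" using high cz(4) by simp
        then show ?thesis using cz gens(1) by (simp add: J.I_l_closed)
      qed
    qed
    moreover have "Idl {f, g} \<subseteq> I" using f g by (simp add: genideal_minimal[OF I])
    ultimately show ?thesis using fg by (intro exI[of _ "{f, g}"]) auto
  qed
qed

text \<open>In a regular sequence \<open>x, y, ...\<close> some power of \<open>y\<close> lies in
  the ideal of \<open>x\<close>. Cancelling \<open>y\<close> modulo that ideal one factor at a time
  would put the unit element into it.\<close>

lemma depth_eq_one: "depth R \<mm> = 1"
  unfolding depth_def
proof (rule antisym[OF Sup_least Sup_upper])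
  fix e
  assume "e \<in> {enat (length xs) | xs. set xs \<subseteq> \<mm> \<and> regular_sequence R xs}"
  then obtain xs where xs: "e = enat (length xs)" "set xs \<subseteq> \<mm>" "regular_sequence R xs" by blast
  have "length xs \<le> 1"
  proof (rule ccontr)
    assume "\<not> length xs \<le> 1"
    then obtain x y zs where eq: "xs = x # y # zs"
      by (cases xs; cases "tl xs") auto
    have mem: "x \<in> carrier R" "y \<in> \<mm>" "y \<in> carrier R" "set xs \<subseteq> carrier R"
      using xs(2) by (auto simp: eq \<mm>_def)
    have step: "xs ! i \<otimes> r \<in> Idl (set (take i xs)) \<Longrightarrow> r \<in> Idl (set (take i xs))"
      if "i < length xs" "r \<in> carrier R" for i r
      using xs(3) that by (simp add: regular_sequence_def)
    \<comment> \<open>If \<open>x\<close> were zero, regularity at position 0 applied to the unit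
      element would make it zero.\<close>
    have "x \<noteq> \<zero>"
      using step[of 0 \<one>] by (auto simp: eq genideal_empty)
    moreover have ideal_x: "ideal (Idl {x}) R" "x \<in> Idl {x}"
      using mem by (simp_all add: genideal_ideal genideal_self')
    ultimately obtain n :: nat where "y [^] n \<in> Idl {x}"
      using exists_pow_in_ideal mem(2) by blast
    then have "\<one> \<in> Idl {x}"
    proof (induction n)
      case (Suc n)
      have "y [^] Suc n = y \<otimes> y [^] n" using mem(3) by (simp add: m_comm)
      then show ?case using Suc step[of 1 "y [^] n"] mem(3) by (simp add: eq)
    qed simp
    also have "Idl {x} \<subseteq> Idl (set xs)"
      using mem(4) genideal_self[OF mem(4)] by (intro genideal_minimal genideal_ideal) (auto simp: eq)
    finally have "Idl (set xs) = carrier R"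
      using genideal_ideal[OF mem(4)] ideal.one_imp_carrier by blast
    then show False using xs(3) by (simp add: regular_sequence_def)
  qed
  then show "e \<le> 1" by (simp add: xs(1) one_enat_def)
next
  obtain b where b: "b \<in> carrier R" "v b = 2" using two_in_range by auto
  have b': "b \<in> \<mm>" "b \<noteq> \<zero>" using b v_zero by (auto simp: \<mm>_def)
  have "Idl {b} \<subseteq> \<mm>" using genideal_minimal[OF ideal_\<mm>] b' by simp
  then have "Idl {b} \<noteq> carrier R" using one_notin_\<mm> by auto
  then have "regular_sequence R [b]"
    using b b' integral by (auto simp: regular_sequence_def genideal_empty)
  then show "1 \<in> {enat (length xs) | xs. set xs \<subseteq> \<mm> \<and> regular_sequence R xs}"
    using b' by (auto simp: one_enat_def intro!: exI[of _ "[b]"])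
qed

lemma cohen_macaulay: "cohen_macaulay_local_ring R \<mm>"
  by (intro cohen_macaulay_local_ring.intro local_ring.intro local_ring_axioms.intro
      cohen_macaulay_local_ring_axioms.intro is_cring noetherian maximalideal_\<mm>
      maximalideal_unique) (simp_all only: depth_eq_one krull_dim_eq_one)

section \<open>Powers of the maximal ideal and the parameter ideal of an element of order 2\<close>

lemma ideal_power_Suc: "ideal_power R I (Suc n) = ideal_prod R (ideal_power R I n) I"
  by (simp add: ideals_set_def nat_pow_def)

lemma ideal_power_zero: "ideal_power R I 0 = carrier R"
  by (simp add: ideals_set_def nat_pow_def)

lemma ideal_power_one: "ideal I R \<Longrightarrow> ideal_power R I 1 = I"
  using ideal_prod_one[of I] unfolding One_nat_def ideal_power_Suc ideal_power_zero 
  by (simp add: ideal_prod_commute oneideal)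

lemma ideal_ideal_power: "ideal I R \<Longrightarrow> ideal (ideal_power R I n) R"
  by (induction n) (simp_all only: ideal_power_Suc ideal_power_zero oneideal ideal_prod_is_ideal)

lemma principal_ideal_eq: "b \<in> carrier R \<Longrightarrow> Idl {b} = {z \<otimes> b | z. z \<in> carrier R}"
  using cgenideal_eq_genideal[of b] by (auto simp: cgenideal_def)

lemma v_ge_four_in_ideal:
  assumes b: "b \<in> carrier R" "v b = 2" and x: "x \<in> carrier R" "4 \<le> v x"
  shows "x \<in> Idl {b}"
  using ideal_above_conductor[OF genideal_ideal genideal_self'] assms by simp

lemma system_of_parameters_v_two:
  assumes b: "b \<in> carrier R" "v b = 2"
  shows "system_of_parameters R \<mm> [b]"
proof -
  have bm: "b \<in> \<mm>" "b \<noteq> \<zero>" using b v_zero by (auto simp: \<mm>_def)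
  have ideal: "ideal (Idl {b}) R" using b by (simp add: genideal_ideal)
  have "ideal_radical R (Idl {b}) = \<mm>"
  proof
    show "\<mm> \<subseteq> ideal_radical R (Idl {b})"
      using exists_pow_in_ideal[OF ideal genideal_self'[OF b(1)] bm(2)]
      by (auto simp: ideal_radical_def \<mm>_def)
    show "ideal_radical R (Idl {b}) \<subseteq> \<mm>"
    proof
      fix x assume "x \<in> ideal_radical R (Idl {b})"
      then obtain n :: nat where x: "x \<in> carrier R" "x [^] n \<in> Idl {b}"
        by (auto simp: ideal_radical_def)
      then have "x [^] n \<in> \<mm>" using genideal_minimal[OF ideal_\<mm>, of "{b}"] bm by auto
      \<comment> \<open>All powers of an element of order 0 have order 0 and so lie outside
        \<open>\<mm>\<close>.\<close>
      then have "v x \<noteq> 0" using v_pow[OF x(1), of n] by (auto simp: \<mm>_def)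
      then show "x \<in> \<mm>" using x by (simp add: \<mm>_def enat_one_le_iff)
    qed
  qed
  then show ?thesis
    using bm by (simp add: system_of_parameters_def krull_dim_eq_one one_enat_def)
qed

text \<open>An element of order 3 is no multiple of \<open>b\<close>, since the cofactor would have
  order 1. Products of two elements of \<open>\<mm>\<close> have order at least 4 and are multiples
  of \<open>b\<close>. So the exponents in question are exactly 0 and 1, and \<open>Max\<close> is
  taken over a finite nonempty set.\<close>

lemma Max_powers:
  assumes b: "b \<in> carrier R" "v b = 2"
  shows "Max {n. \<not> ideal_power R \<mm> n \<subseteq> Idl {b}} = 1"
proof -
  have "b \<in> \<mm>" using b by (simp add: \<mm>_def)
  then have sub: "Idl {b} \<subseteq> \<mm>" using genideal_minimal[OF ideal_\<mm>, of "{b}"] by simp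
  have zero: "\<not> ideal_power R \<mm> 0 \<subseteq> Idl {b}"
    using sub one_notin_\<mm> by (auto simp only: ideal_power_zero)
  obtain c where c: "c \<in> carrier R" "v c = 3" using three_in_range by auto
  have "c \<notin> Idl {b}"
  proof
    assume "c \<in> Idl {b}"
    then obtain z where "z \<in> carrier R" "c = z \<otimes> b" using principal_ideal_eq b by auto
    then show False
      using v_neq_one[of z] v_mult[of z b] b c
      by (cases "v z") (auto simp: numeral_eq_enat one_enat_def)
  qed
  then have one: "\<not> ideal_power R \<mm> 1 \<subseteq> Idl {b}"
    using c unfolding ideal_power_one[OF ideal_\<mm>] by (auto simp: \<mm>_def)
  have sq: "4 \<le> v x" if "x \<in> ideal_prod R \<mm> \<mm>" for x
    using that
  proof induction
    case (prod i j)
    then have "2 \<le> v i" "2 \<le> v j" "i \<in> carrier R" "j \<in> carrier R"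
      using two_le_v by (auto simp: \<mm>_def)
    then show ?case using add_mono[of 2 "v i" 2 "v j"] by (simp add: v_mult)
  next
    case (sum x y)
    moreover have "x \<in> carrier R" "y \<in> carrier R"
      using sum ideal_prod_in_carrier[OF ideal_\<mm> ideal_\<mm>] by auto
    ultimately show ?case using v_add[of x y] by (metis min.boundedI order_trans)
  qed
  have large: "ideal_power R \<mm> (n + 2) \<subseteq> Idl {b}" for n
  proof (induction n)
    case 0
    have "ideal_power R \<mm> (0 + 2) = ideal_prod R \<mm> \<mm>"
      using ideal_power_Suc[of \<mm> 1] ideal_power_one[OF ideal_\<mm>] by (simp add: numeral_2_eq_2)
    then show ?case
      using sq v_ge_four_in_ideal[OF b] ideal_prod_in_carrier[OF ideal_\<mm> ideal_\<mm>] by auto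
  next
    case (Suc n)
    then show ?case
      using ideal_prod_inter[OF ideal_ideal_power[OF ideal_\<mm>] ideal_\<mm>, of "n + 2"]
      unfolding add_Suc ideal_power_Suc by blast
  qed
  have "{n. \<not> ideal_power R \<mm> n \<subseteq> Idl {b}} = {0, 1}"
  proof (intro equalityI subsetI)
    fix n assume "n \<in> {n. \<not> ideal_power R \<mm> n \<subseteq> Idl {b}}"
    then have "n \<noteq> k + 2" for k using large[of k] by blast
    then have "\<not> 2 \<le> n" using le_Suc_ex[of 2 n] by (auto simp: add.commute)
    then show "n \<in> {0, 1}" by auto
  qed (use zero one in auto)
  then show ?thesis by simp
qed

text \<open>
  Modulo elements of order at least 3, \<open>r\<close> is a multiple \<open>c b\<close> of \<open>b\<close>; then \<open>(r - c b)\<^sup>2\<close>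
  lies in \<open>(b\<^sup>2)\<close>, and expanding the square gives an equation of integral dependence.
\<close>

lemma \<mm>_subset_integral_closure:
  assumes b: "b \<in> carrier R" "v b = 2"
  shows "\<mm> \<subseteq> ideal_integral_closure R (Idl {b})"
proof
  fix r assume "r \<in> \<mm>"
  then have r: "r \<in> carrier R" "2 \<le> v r" using two_le_v by (auto simp: \<mm>_def)
  \<comment> \<open>If the order of \<open>r\<close> already exceeds 2, then \<open>c\<close> is
    zero and \<open>z\<close> is \<open>r\<close>.\<close>
  have "\<exists>c\<in>carrier R. \<exists>z\<in>carrier R. r = c \<otimes> b \<oplus> z \<and> 2 < v z"
  proof (cases "v r = 2")
    case True
    moreover have "b \<noteq> \<zero>" using b v_zero by auto
    ultimately show ?thesis using leading_term[of b r] r b by simp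
  next
    case False
    then show ?thesis using r b by (intro bexI[of _ \<zero>] bexI[of _ r]) auto
  qed
  then obtain c z where cz: "c \<in> carrier R" "z \<in> carrier R" "r = c \<otimes> b \<oplus> z" "2 < v z" by blast
  have "3 \<le> v z" using cz(4) by (cases "v z") (auto simp: numeral_eq_enat)
  \<comment> \<open>The bound is just met: the square of \<open>z\<close> has order at least 6, and
    the square of \<open>b\<close> has order 4.\<close>
  then have "v (b \<otimes> b) + 2 \<le> v (z \<otimes> z)"
    using b cz(2) add_mono[of 3 "v z" 3 "v z"] by (simp add: v_mult)
  then obtain w where w: "w \<in> carrier R" "z \<otimes> z = w \<otimes> (b \<otimes> b)"
    using conductor[of "b \<otimes> b" "z \<otimes> z"] b cz by auto
  let ?J = "Idl {b}"
  \<comment> \<open>Coefficients of \<open>(X - c b)^2 - w b^2\<close>, a monic quadratic vanishing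
    at \<open>r\<close>. The second branch matters only at index 2.\<close>
  define a where "a i = (if i = 1 then \<ominus> (c \<oplus> c) \<otimes> b else (c \<otimes> c \<ominus> w) \<otimes> (b \<otimes> b))" for i :: nat
  have J: "ideal ?J R" "b \<in> ?J" using b by (simp_all add: genideal_ideal genideal_self')
  have "b \<otimes> b \<in> ideal_power R ?J 2"
    using ideal_prod.prod[OF J(2) J(2)] ideal_power_Suc[of ?J 1] ideal_power_one[OF J(1)]
    by (simp add: numeral_2_eq_2)
  then have "a 2 \<in> ideal_power R ?J 2"
    using ideal.I_l_closed[OF ideal_ideal_power[OF J(1)]] cz w by (simp add: a_def)
  moreover have "a 1 \<in> ideal_power R ?J 1"
    using ideal.I_l_closed[OF J] cz unfolding ideal_power_one[OF J(1)] by (simp add: a_def)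
  moreover have "{1..2} = {1, 2::nat}" by auto
  moreover have "r [^] (2::nat) \<oplus> (\<Oplus>i\<in>{1..2}. a i \<otimes> r [^] (2 - i)) = \<zero>"
  proof -
    have ac: "a i \<in> carrier R" for i using cz w b by (simp add: a_def)
    \<comment> \<open>With \<open>r = B + z\<close> the equation becomes
      \<open>(B + z)^2 - 2 B (B + z) + B^2 - z^2 = 0\<close>.\<close>
    define B where "B = c \<otimes> b"
    have B: "B \<in> carrier R" "r = B \<oplus> z" using cz b by (simp_all add: B_def)
    have a1: "a 1 = \<ominus> (B \<oplus> B)" using cz b by (simp add: a_def B_def l_distr l_minus)
    have a2: "a 2 = B \<otimes> B \<ominus> z \<otimes> z"
      using cz b w by (simp add: a_def B_def minus_eq l_distr r_distr l_minus r_minus m_ac)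
    have "(\<Oplus>i\<in>{1..2}. a i \<otimes> r [^] (2 - i)) = a 1 \<otimes> r \<oplus> a 2"
      unfolding \<open>{1..2} = {1, 2::nat}\<close> using ac r by simp
    then show ?thesis
      using B cz(2) unfolding a1 a2
      by (simp add: numeral_2_eq_2 minus_eq l_distr r_distr l_minus r_minus minus_add a_ac m_ac r_neg r_neg1 r_neg2)
  qed
  ultimately show "r \<in> ideal_integral_closure R ?J"
    using r(1) unfolding ideal_integral_closure_def
    by (intro CollectI conjI exI[of _ 2] exI[of _ a]) auto
qed

section \<open>Transport to another carrier and the power series model\<close>

text \<open>This carries the power series ring, together with its valuation, into the fixed type
  \<open>universe\<close>.\<close>

lemma cusp_domain_image_ring:
  assumes h: "inj_on h (carrier R)"
  shows "cusp_domain (image_ring h R) (\<lambda>x. v (inv_into (carrier R) h x))"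
proof -
  let ?S = "image_ring h R"
  let ?w = "\<lambda>x. v (inv_into (carrier R) h x)"
  interpret S: domain ?S by (rule inj_imp_image_ring_is_domain[OF h])
  have iso: "h \<in> ring_iso R ?S" by (rule inj_imp_image_ring_iso[OF h])
  have S: "carrier ?S = h ` carrier R" by (rule image_ring_carrier)
  have hom: "h x \<otimes>\<^bsub>?S\<^esub> h y = h (x \<otimes> y)" "h x \<oplus>\<^bsub>?S\<^esub> h y = h (x \<oplus> y)"
    if "x \<in> carrier R" "y \<in> carrier R" for x y
    using ring_iso_memE(2,3)[OF iso] that by simp_all
  have w: "?w (h x) = v x" if "x \<in> carrier R" for x
    using h that by (simp add: inv_into_f_f)
  have zero: "h x = \<zero>\<^bsub>?S\<^esub> \<longleftrightarrow> x = \<zero>" if "x \<in> carrier R" for x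
    using h that by (auto simp: image_ring_zero inj_on_eq_iff)
  show ?thesis
  proof unfold_locales
    show "\<exists>x\<in>carrier ?S. ?w x = 2" using two_in_range by (auto simp: S w)
    show "\<exists>x\<in>carrier ?S. ?w x = 3" using three_in_range by (auto simp: S w)
  next
    fix x y assume "x \<in> carrier ?S" "y \<in> carrier ?S" "?w x + 2 \<le> ?w y"
    then show "\<exists>z\<in>carrier ?S. y = z \<otimes>\<^bsub>?S\<^esub> x"
      using conductor by (fastforce simp: S w hom)
  next
    fix x y assume "x \<in> carrier ?S" "y \<in> carrier ?S" "x \<noteq> \<zero>\<^bsub>?S\<^esub>" "?w x = ?w y"
    then obtain x' y' where xy: "x' \<in> carrier R" "y' \<in> carrier R" "x = h x'" "y = h y'"
      "x' \<noteq> \<zero>" "v x' = v y'"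
      by (auto simp: S w zero)
    then obtain c z where "c \<in> carrier R" "z \<in> carrier R" "y' = c \<otimes> x' \<oplus> z" "v x' < v z"
      using leading_term by blast
    then show "\<exists>c\<in>carrier ?S. \<exists>z\<in>carrier ?S. y = c \<otimes>\<^bsub>?S\<^esub> x \<oplus>\<^bsub>?S\<^esub> z \<and> ?w x < ?w z"
      using xy by (intro bexI[of _ "h c"] bexI[of _ "h z"]) (auto simp: S w hom)
  qed (auto simp: S w hom zero v_eq_infinity_iff v_mult v_add v_neq_one)
qed

end

text \<open>This is \<open>k[[t^2, t^3]]\<close>: 1 is the only natural number not of the form
  \<open>2 i + 3 j\<close>, so only the linear coefficient has to vanish.\<close>

definition cusp_ring :: "'k::field fps ring" where
  "cusp_ring = \<lparr>carrier = {f. fps_nth f 1 = 0}, monoid.mult = (*), one = 1, ring.zero = 0, add = (+)\<rparr>"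

lemma cring_cusp_ring: "cring (cusp_ring :: 'k::field fps ring)"
proof (rule cringI)
  show "abelian_group (cusp_ring :: 'k fps ring)"
  proof (rule abelian_groupI)
    fix f :: "'k fps" assume "f \<in> carrier cusp_ring"
    then show "\<exists>g\<in>carrier cusp_ring. g \<oplus>\<^bsub>cusp_ring\<^esub> f = \<zero>\<^bsub>cusp_ring\<^esub>"
      by (intro bexI[of _ "- f"]) (auto simp: cusp_ring_def)
  qed (auto simp: cusp_ring_def)
  \<comment> \<open>Closure under products: the linear coefficient of \<open>f g\<close> is
    \<open>f_0 g_1 + f_1 g_0\<close>.\<close>
  show "comm_monoid (cusp_ring :: 'k fps ring)"
    by (rule comm_monoidI) (auto simp: cusp_ring_def fps_mult_nth)
qed (auto simp: cusp_ring_def algebra_simps)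

text \<open>The order of zero is set by hand, because \<open>subdegree 0\<close> is 0 rather than
  infinite.\<close>

lemma cusp_domain_cusp_ring:
  "cusp_domain (cusp_ring :: 'k::field fps ring) (\<lambda>f. if f = 0 then \<infinity> else enat (subdegree f))"
proof -
  let ?R = "cusp_ring :: 'k fps ring"
  let ?v = "\<lambda>f :: 'k fps. if f = 0 then \<infinity> else enat (subdegree f)"
  note simps = cusp_ring_def numeral_eq_enat one_enat_def
  have domain: "domain ?R"
    by (rule domain.intro[OF cring_cusp_ring]) (unfold_locales, auto simp: cusp_ring_def)
  show ?thesis
  proof (rule cusp_domain.intro[OF domain], unfold_locales)
    fix f g assume fg: "f \<in> carrier ?R" "g \<in> carrier ?R"
    show "min (?v f) (?v g) \<le> ?v (f \<oplus>\<^bsub>?R\<^esub> g)"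
      using subdegree_add_ge'[of f g] by (auto simp: cusp_ring_def min_def)
    show "\<exists>q\<in>carrier ?R. g = q \<otimes>\<^bsub>?R\<^esub> f" if le: "?v f + 2 \<le> ?v g"
    proof (cases "g = 0")
      case True
      then show ?thesis by (intro bexI[of _ 0]) (auto simp: cusp_ring_def)
    next
      case False
      with le have nz: "f \<noteq> 0" "subdegree f + 2 \<le> subdegree g"
        by (auto simp: simps split: if_splits)
      then obtain q where q: "g = f * q"
        using fps_dvd_iff[of f g] False by (auto elim: dvdE)
      \<comment> \<open>A quotient of order at least 2 has no linear term and so belongs to the
        ring.\<close>
      then have "q \<noteq> 0" "2 \<le> subdegree q" using nz False by auto
      then show ?thesis
        using q nth_less_subdegree_zero[of 1 q] by (intro bexI[of _ q]) (auto simp: cusp_ring_def)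
    qed
    show "\<exists>c\<in>carrier ?R. \<exists>q\<in>carrier ?R. g = c \<otimes>\<^bsub>?R\<^esub> f \<oplus>\<^bsub>?R\<^esub> q \<and> ?v f < ?v q"
      if "f \<noteq> \<zero>\<^bsub>?R\<^esub>" "?v f = ?v g"
    proof -
      have nz: "f \<noteq> 0" "g \<noteq> 0" "subdegree f = subdegree g"
        using that by (auto simp: cusp_ring_def split: if_splits)
      define n where "n = subdegree f"
      \<comment> \<open>The ratio of the leading coefficients; as a constant series it lies in the
        ring.\<close>
      define c where "c = fps_const (fps_nth g n / fps_nth f n)"
      have "fps_nth (g - c * f) i = 0" if "i \<le> n" for i
      proof (cases "i = n")
        case True
        have "fps_nth f n \<noteq> 0" unfolding n_def using nz(1) by (rule nth_subdegree_nonzero)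
        then show ?thesis by (simp add: True c_def)
      next
        case False
        then have "fps_nth f i = 0" "fps_nth g i = 0"
          using that nz(3) by (auto simp: n_def intro: nth_less_subdegree_zero)
        then show ?thesis by (simp add: c_def)
      qed
      then have "?v f < ?v (g - c * f)"
        using nz(1) subdegree_greaterI[of "g - c * f" n] by (auto simp: n_def)
      then show ?thesis
        using fg by (intro bexI[of _ c] bexI[of _ "g - c * f"]) (auto simp: cusp_ring_def c_def)
    qed
  next
    show "\<exists>f\<in>carrier ?R. ?v f = 2"
      by (intro bexI[of _ "fps_X ^ 2"]) (auto simp: simps fps_X_power_subdegree)
    show "\<exists>f\<in>carrier ?R. ?v f = 3"
      by (intro bexI[of _ "fps_X ^ 3"]) (auto simp: simps fps_X_power_subdegree)
  qed (auto simp: simps dest: nth_subdegree_nonzero)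
qed

theorem mainTheorem7:
  shows "\<exists>(p :: nat) (R :: universe ring) \<mm> (d :: nat) xs J.
    Factorial_Ring.prime p \<and> cohen_macaulay_local_ring R \<mm> \<and> has_characteristic R p \<and>
    krull_dim R = enat d \<and> d \<ge> 1 \<and>
    system_of_parameters R \<mm> xs \<and> J = Idl\<^bsub>R\<^esub> (set xs) \<and>
    (let a = Max {n. \<not> ideal_power R \<mm> n \<subseteq> J} in
      \<not> (\<forall>s::nat. s \<ge> 1 \<longrightarrow>
           (ideal_power R \<mm> s \<subseteq> ideal_integral_closure R J \<longleftrightarrow>
            real s \<ge> real a / real d + 1)))"
proof -
  \<comment> \<open>Over the field with two elements a series is determined by its support.\<close>
  define h :: "bit fps \<Rightarrow> universe" where "h f = {n. fps_nth f n = 1}" for f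
  have "inj h"
  proof (rule injI, rule fps_ext)
    fix f g n assume "h f = h g"
    then have "n \<in> h f \<longleftrightarrow> n \<in> h g" by simp
    then show "fps_nth f n = fps_nth g n" by (cases "fps_nth f n"; cases "fps_nth g n") (auto simp: h_def)
  qed
  define R where "R = image_ring h cusp_ring"
  define v where "v x = (let f = inv_into (carrier cusp_ring) h x in
    if f = 0 then \<infinity> else enat (subdegree f))" for x
  interpret cusp_domain R v
    unfolding R_def v_def Let_def
    by (rule cusp_domain.cusp_domain_image_ring[OF cusp_domain_cusp_ring inj_on_subset[OF \<open>inj h\<close>]])
      simp
  have iso: "h \<in> ring_iso cusp_ring R"
    unfolding R_def by (rule inj_imp_image_ring_iso[OF inj_on_subset[OF \<open>inj h\<close>]]) simp
  have "\<one>\<^bsub>R\<^esub> \<oplus>\<^bsub>R\<^esub> \<one>\<^bsub>R\<^esub> = h (1 + 1)"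
    using ring_iso_memE(3)[OF iso, of 1 1] ring_iso_memE(4)[OF iso] by (simp add: cusp_ring_def)
  also have "(1 + 1 :: bit fps) = 0" by (rule fps_ext) (simp add: fps_numeral_nth)
  also have "h 0 = \<zero>\<^bsub>R\<^esub>" by (simp add: R_def image_ring_zero cusp_ring_def)
  finally have char: "has_characteristic R 2" by (rule has_characteristic_two) simp
  obtain b where b: "b \<in> carrier R" "v b = 2" using two_in_range by auto
  \<comment> \<open>The witnesses are \<open>p = 2\<close>, \<open>d = 1\<close> and
    \<open>J\<close> generated by \<open>b\<close>. At \<open>s = 1\<close> the inclusion holds
    while the bound \<open>a / d + 1\<close> equals 2.\<close>
  show ?thesis
    using cohen_macaulay char krull_dim_eq_one system_of_parameters_v_two[OF b]
      \<mm>_subset_integral_closure[OF b] Max_powers[OF b] ideal_power_one[OF ideal_\<mm>]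
    by (intro exI[of _ 2] exI[of _ R] exI[of _ \<mm>] exI[of _ 1] exI[of _ "[b]"] exI[of _ "Idl\<^bsub>R\<^esub> {b}"])
      (auto simp: one_enat_def Let_def intro!: exI[of _ 1])
qed

end
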